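(* Let $T$ be a left continuous t-norm with R-implication $I_T$, let $A,A',A'',A_1$ be fuzzy sets on $U$, let $B,B_1$ be fuzzy sets on $V$, and let $\alpha_1,\alpha_2,\alpha_3\in[0,1]$. Define, for $y\in V$, $$B'_2(y)=\inf_{x\in U}I_T\bigl(S_F(A',A),I_T(A(x),B(y))\bigr),\qquad B''_2(y)=\inf_{x\in U}I_T\bigl(S_F(A'',A_1),I_T(A_1(x),B_1(y))\bigr).$$ If $A'\sim^{S_F}_{\alpha_1}A''$, $A\sim^{S_F}_{\alpha_2}A_1$ and $B\sim^{S_F}_{\alpha_3}B_1$, then $B_2'\sim^{S_F}_{T(\beta,\alpha_2,\alpha_3)}B_2''$, where $\beta=F\bigl(S_F(A',A),S_F(A'',A_1)\bigr)$.
   Context: A t-norm is a commutative, associative map $T:[0,1]^2\to[0,1]$, non-decreasing in each variable, with neutral element $1$; $T(a,b,c)=T(T(a,b),c)$. Its R-implication is $I_T(x,y)=\sup\{a\in[0,1]\mid T(x,a)\le y\}$. Put $F(x,y)=T(I_T(x,y),I_T(y,x))$ for $x,y\in[0,1]$. A fuzzy set on a nonempty universe $W$ is a map $W\to[0,1]$; for fuzzy sets $C,D$ on $W$, $S_F(C,D)=\inf_{w\in W}F(C(w),D(w))$, and $C\sim^{S_F}_\alpha D$ means $S_F(C,D)\ge\alpha$. *)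

theory Defs
  imports "HOL-Analysis.Analysis"
begin

text \<open>
  Operations on the unit interval are functions on \<open>real\<close> whose values outside \<open>{0..1}\<close> are
  irrelevant; every requirement and every supremum or infimum below is relativised to \<open>{0..1}\<close>
  or to the universe of a fuzzy set.
\<close>

definition t_norm :: "(real \<Rightarrow> real \<Rightarrow> real) \<Rightarrow> bool" where
  "t_norm T \<longleftrightarrow>
     (\<forall>x\<in>{0..1}. \<forall>y\<in>{0..1}. T x y \<in> {0..1}) \<and>
     (\<forall>x\<in>{0..1}. \<forall>y\<in>{0..1}. T x y = T y x) \<and>
     (\<forall>x\<in>{0..1}. \<forall>y\<in>{0..1}. \<forall>z\<in>{0..1}. T (T x y) z = T x (T y z)) \<and>
     (\<forall>y\<in>{0..1}. mono_on {0..1} (\<lambda>x. T x y)) \<and>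
     (\<forall>x\<in>{0..1}. mono_on {0..1} (T x)) \<and>
     (\<forall>x\<in>{0..1}. T x 1 = x \<and> T 1 x = x)"

text \<open>
  Left continuity in each variable. The point \<open>0\<close> is left out because it has no left
  neighbourhood inside the unit interval.
\<close>

definition left_continuous :: "(real \<Rightarrow> real \<Rightarrow> real) \<Rightarrow> bool" where
  "left_continuous T \<longleftrightarrow>
     (\<forall>y\<in>{0..1}. \<forall>x\<in>{0<..1}. continuous (at_left x) (\<lambda>z. T z y)) \<and>
     (\<forall>x\<in>{0..1}. \<forall>y\<in>{0<..1}. continuous (at_left y) (T x))"

definition R_impl :: "(real \<Rightarrow> real \<Rightarrow> real) \<Rightarrow> real \<Rightarrow> real \<Rightarrow> real" where
  "R_impl T x y = Sup {a \<in> {0..1}. T x a \<le> y}"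

definition F_op :: "(real \<Rightarrow> real \<Rightarrow> real) \<Rightarrow> real \<Rightarrow> real \<Rightarrow> real" where
  "F_op T x y = T (R_impl T x y) (R_impl T y x)"

definition fuzzy_set :: "'a set \<Rightarrow> ('a \<Rightarrow> real) \<Rightarrow> bool" where
  "fuzzy_set W C \<longleftrightarrow> C \<in> W \<rightarrow> {0..1}"

definition S_F :: "(real \<Rightarrow> real \<Rightarrow> real) \<Rightarrow> 'a set \<Rightarrow> ('a \<Rightarrow> real) \<Rightarrow> ('a \<Rightarrow> real) \<Rightarrow> real" where
  "S_F T W C D = (INF w\<in>W. F_op T (C w) (D w))"

definition similar ::
  "(real \<Rightarrow> real \<Rightarrow> real) \<Rightarrow> 'a set \<Rightarrow> real \<Rightarrow> ('a \<Rightarrow> real) \<Rightarrow> ('a \<Rightarrow> real) \<Rightarrow> bool" where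
  "similar T W \<alpha> C D \<longleftrightarrow> S_F T W C D \<ge> \<alpha>"

end

theory Submission
  imports Defs
begin

text \<open>
  A left continuous t-norm is residuated: for \<open>a, x, y\<close> in the unit interval,
  \<open>a \<le> I x y\<close> holds if and only if \<open>T a x \<le> y\<close> (\<open>le_R_impl_iff\<close>). Moreover the unit
  interval is a chain, so one of \<open>I x y\<close> and \<open>I y x\<close> is \<open>1\<close> and \<open>F x y\<close> is simply the smaller
  of the two. Hence \<open>c \<le> F x y\<close> means that both \<open>c \<le> I x y\<close> and \<open>c \<le> I y x\<close>
  (\<open>le_F_op_iff\<close>), that is, \<open>T c x \<le> y\<close> and \<open>T c y \<le> x\<close>. A similarity of fuzzy sets
  is therefore a pair of pointwise one-sided inequalities (\<open>similar_iff\<close>).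

  Write \<open>s = S\<^sub>F(A', A)\<close> and \<open>s' = S\<^sub>F(A'', A\<^sub>1)\<close>. One half of the conclusion at a point \<open>y\<close>
  asks for \<open>T (T (T \<beta> \<alpha>\<^sub>2) \<alpha>\<^sub>3) (B\<^sub>2' y) \<le> B\<^sub>2'' y\<close>. Residuating the two nested implications
  in each term of the infimum \<open>B\<^sub>2'' y\<close>, this says that the \<open>T\<close>-product of
  \<open>\<beta>\<close>, \<open>\<alpha>\<^sub>2\<close>, \<open>\<alpha>\<^sub>3\<close>, \<open>B\<^sub>2' y\<close>, \<open>s'\<close>, \<open>A\<^sub>1 x\<close> is at most \<open>B\<^sub>1 y\<close>. Regroup the product:
  \<open>\<beta>\<close> turns \<open>s'\<close> into \<open>s\<close>, \<open>\<alpha>\<^sub>2\<close> turns \<open>A\<^sub>1 x\<close> into \<open>A x\<close>, the product of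
  \<open>B\<^sub>2' y\<close>, \<open>s\<close> and \<open>A x\<close> is at most \<open>B y\<close> by the definition of \<open>B\<^sub>2'\<close>, and \<open>\<alpha>\<^sub>3\<close> turns
  \<open>B y\<close> into \<open>B\<^sub>1 y\<close> (\<open>T_nested_R_impl_le\<close>, with \<open>le_R_impl_INF\<close> for the infima). The other half
  is the same argument with the two rules exchanged.
\<close>

locale left_continuous_t_norm =
  fixes T :: "real \<Rightarrow> real \<Rightarrow> real"
  assumes t_norm: "t_norm T" and left_continuous: "left_continuous T"
begin

abbreviation I :: "real \<Rightarrow> real \<Rightarrow> real" where "I \<equiv> R_impl T"

lemma T_closed [simp, intro]: "x \<in> {0..1} \<Longrightarrow> y \<in> {0..1} \<Longrightarrow> T x y \<in> {0..1}"
  using t_norm unfolding t_norm_def by blast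

lemma T_commute: "x \<in> {0..1} \<Longrightarrow> y \<in> {0..1} \<Longrightarrow> T x y = T y x"
  using t_norm unfolding t_norm_def by blast

lemma T_assoc:
  "x \<in> {0..1} \<Longrightarrow> y \<in> {0..1} \<Longrightarrow> z \<in> {0..1} \<Longrightarrow> T (T x y) z = T x (T y z)"
  using t_norm unfolding t_norm_def by blast

lemma T_left_commute:
  assumes "x \<in> {0..1}" "y \<in> {0..1}" "z \<in> {0..1}"
  shows "T x (T y z) = T y (T x z)"
  using T_assoc[of x y z] T_assoc[of y x z] T_commute[of x y] assms by simp

lemma T_one [simp]: "x \<in> {0..1} \<Longrightarrow> T x 1 = x" "x \<in> {0..1} \<Longrightarrow> T 1 x = x"
  using t_norm unfolding t_norm_def by blast+

lemma T_mono:
  assumes "x \<in> {0..1}" "x' \<in> {0..1}" "y \<in> {0..1}" "y' \<in> {0..1}" "x \<le> x'" "y \<le> y'"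
  shows "T x y \<le> T x' y'"
proof -
  have "mono_on {0..1} (\<lambda>x. T x y)" "mono_on {0..1} (T x')"
    using t_norm assms unfolding t_norm_def by blast+
  then have "T x y \<le> T x' y" "T x' y \<le> T x' y'"
    using assms by (auto intro: mono_onD[of "{0..1}" "\<lambda>x. T x y"] mono_onD[of "{0..1}" "T x'"]
        simp del: atLeastAtMost_iff)
  then show ?thesis by simp
qed

lemma T_le_right: "x \<in> {0..1} \<Longrightarrow> y \<in> {0..1} \<Longrightarrow> T x y \<le> y"
  using T_mono[of x 1 y y] by simp

lemma zero_mem_R_impl_set:
  assumes "x \<in> {0..1}" "y \<in> {0..1}"
  shows "0 \<in> {a \<in> {0..1}. T x a \<le> y}"
  using T_le_right[of x 0] assms by simp

lemma bdd_above_R_impl_set: "bdd_above {a \<in> {0..1}. T x a \<le> (y::real)}"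
  by (rule bdd_aboveI[of _ 1]) simp

lemma R_impl_closed [simp, intro]:
  assumes "x \<in> {0..1}" "y \<in> {0..1}"
  shows "I x y \<in> {0..1}"
proof -
  have "0 \<le> I x y"
    unfolding R_impl_def
    using zero_mem_R_impl_set[OF assms] bdd_above_R_impl_set by (rule cSup_upper)
  moreover have "I x y \<le> 1"
    unfolding R_impl_def
    by (rule cSup_least) (use zero_mem_R_impl_set[OF assms] in blast, simp)
  ultimately show ?thesis by simp
qed

text \<open>
  Modus ponens for the residuum, the only place where left continuity enters: it makes the
  supremum defining \<open>I x y\<close> attained, because every point strictly below the supremum
  satisfies \<open>T x a \<le> y\<close> and this passes to the left limit.
\<close>

lemma T_R_impl_le:
  assumes x: "x \<in> {0..1}" and y: "y \<in> {0..1}"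
  shows "T x (I x y) \<le> y"
proof (cases "I x y = 0")
  case True
  then show ?thesis
    using zero_mem_R_impl_set[OF x y] by simp
next
  case False
  then have pos: "I x y \<in> {0<..1}"
    using R_impl_closed[OF x y] by auto
  have below: "T x z \<le> y" if z: "z \<in> {0<..<I x y}" for z
  proof -
    from z have "z < Sup {a \<in> {0..1}. T x a \<le> y}"
      by (simp add: R_impl_def)
    then obtain a where a: "a \<in> {0..1}" "T x a \<le> y" "z < a"
      using zero_mem_R_impl_set[OF x y] less_cSupD[of "{a \<in> {0..1}. T x a \<le> y}" z] by blast
    have "T x z \<le> T x a"
      using x z pos a by (intro T_mono) auto
    with a show ?thesis by simp
  qed
  have "eventually (\<lambda>z. z \<in> {0<..<I x y}) (at_left (I x y))"
    using pos by (intro eventually_at_left_real) auto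
  then have "eventually (\<lambda>z. T x z \<le> y) (at_left (I x y))"
    by eventually_elim (rule below)
  moreover have "continuous (at_left (I x y)) (T x)"
    using left_continuous x pos unfolding left_continuous_def by blast
  then have "(T x \<longlongrightarrow> T x (I x y)) (at_left (I x y))"
    by (simp add: continuous_within)
  ultimately show ?thesis
    by (intro tendsto_upperbound) auto
qed

lemma le_R_impl_iff:
  assumes "a \<in> {0..1}" "x \<in> {0..1}" "y \<in> {0..1}"
  shows "a \<le> I x y \<longleftrightarrow> T a x \<le> y"
proof
  assume "a \<le> I x y"
  then have "T x a \<le> T x (I x y)"
    using assms by (intro T_mono R_impl_closed order_refl)
  then show "T a x \<le> y"
    using T_R_impl_le[of x y] T_commute[of a x] assms by simp
next
  assume "T a x \<le> y"
  then have "a \<in> {a \<in> {0..1}. T x a \<le> y}"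
    using T_commute[of a x] assms by simp
  then show "a \<le> I x y"
    unfolding R_impl_def using bdd_above_R_impl_set by (rule cSup_upper)
qed

lemma R_impl_eq_1:
  assumes "x \<in> {0..1}" "y \<in> {0..1}" "x \<le> y"
  shows "I x y = 1"
  using le_R_impl_iff[of 1 x y] R_impl_closed[of x y] assms by simp

lemma F_op_eq_min:
  assumes "x \<in> {0..1}" "y \<in> {0..1}"
  shows "F_op T x y = min (I x y) (I y x)"
proof (cases "x \<le> y")
  case True
  then show ?thesis
    using assms R_impl_eq_1[of x y] R_impl_closed[of y x] by (simp add: F_op_def)
next
  case False
  then show ?thesis
    using assms R_impl_eq_1[of y x] R_impl_closed[of x y] by (simp add: F_op_def)
qed

lemma le_F_op_iff:
  assumes "x \<in> {0..1}" "y \<in> {0..1}"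
  shows "c \<le> F_op T x y \<longleftrightarrow> c \<le> I x y \<and> c \<le> I y x"
  using assms by (simp add: F_op_eq_min)

lemma F_op_closed [simp, intro]:
  "x \<in> {0..1} \<Longrightarrow> y \<in> {0..1} \<Longrightarrow> F_op T x y \<in> {0..1}"
  by (simp add: F_op_def del: atLeastAtMost_iff)

lemma INF_closed:
  fixes f :: "'a \<Rightarrow> real"
  assumes "W \<noteq> {}" "\<And>w. w \<in> W \<Longrightarrow> f w \<in> {0..1}"
  shows "(INF w\<in>W. f w) \<in> {0..1}"
proof -
  obtain w where w: "w \<in> W" using assms(1) by blast
  have "bdd_below (f ` W)"
    using assms(2) by (intro bdd_belowI2[of _ 0]) auto
  then have "(INF w\<in>W. f w) \<le> f w"
    using w by (intro cINF_lower)
  moreover have "0 \<le> (INF w\<in>W. f w)"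
    using assms by (intro cINF_greatest) auto
  ultimately show ?thesis using assms(2)[OF w] by simp
qed

lemma S_F_closed:
  assumes "W \<noteq> {}" "fuzzy_set W C" "fuzzy_set W D"
  shows "S_F T W C D \<in> {0..1}"
  unfolding S_F_def using assms
  by (intro INF_closed F_op_closed) (auto simp: fuzzy_set_def)

lemma similar_iff:
  assumes "W \<noteq> {}" "fuzzy_set W C" "fuzzy_set W D"
  shows "similar T W c C D \<longleftrightarrow> (\<forall>w\<in>W. c \<le> I (C w) (D w) \<and> c \<le> I (D w) (C w))"
proof -
  have mem: "C w \<in> {0..1}" "D w \<in> {0..1}" if "w \<in> W" for w
    using assms that by (auto simp: fuzzy_set_def)
  have "bdd_below ((\<lambda>w. F_op T (C w) (D w)) ` W)"
    using F_op_closed[OF mem] by (intro bdd_belowI2[of _ 0]) auto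
  then have "similar T W c C D \<longleftrightarrow> (\<forall>w\<in>W. c \<le> F_op T (C w) (D w))"
    unfolding similar_def S_F_def using assms(1) by (rule le_cINF_iff[rotated])
  then show ?thesis
    using le_F_op_iff[OF mem] by blast
qed

text \<open>
  The regrouping step for a single term of the infimum. The hypotheses on \<open>s\<close> and \<open>a\<close>
  run from the second rule back to the first because \<open>I\<close> is antitone in its first argument.
\<close>

lemma T_nested_R_impl_le:
  assumes mem: "\<beta> \<in> {0..1}" "\<alpha> \<in> {0..1}" "\<gamma> \<in> {0..1}"
      "s \<in> {0..1}" "s' \<in> {0..1}" "a \<in> {0..1}" "a' \<in> {0..1}" "b \<in> {0..1}" "b' \<in> {0..1}"
    and s: "\<beta> \<le> I s' s" and a: "\<alpha> \<le> I a' a" and b: "\<gamma> \<le> I b b'"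
  shows "T (T (T \<beta> \<alpha>) \<gamma>) (I s (I a b)) \<le> I s' (I a' b')"
proof -
  define r where "r = I s (I a b)"
  have r: "r \<in> {0..1}" unfolding r_def using mem by blast
  have "T r s \<le> I a b"
    using mem r le_R_impl_iff[of r s "I a b"] R_impl_closed[of a b] by (simp add: r_def)
  then have rule: "T (T r s) a \<le> b"
    using mem r le_R_impl_iff[of "T r s" a b] T_closed[of r s] by simp
  have \<beta>s: "T \<beta> s' \<le> s" and \<alpha>a: "T \<alpha> a' \<le> a" and \<gamma>b: "T \<gamma> b \<le> b'"
    using s a b mem le_R_impl_iff by blast+
  have "T (T (T (T (T \<beta> \<alpha>) \<gamma>) r) s') a' = T \<gamma> (T (T r (T \<beta> s')) (T \<alpha> a'))"
    using mem r
    by (simp add: T_assoc T_commute T_left_commute T_closed del: atLeastAtMost_iff)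
  also have "\<dots> \<le> T \<gamma> (T (T r s) a)"
    using mem r \<beta>s \<alpha>a by (intro T_mono T_closed order_refl)
  also have "\<dots> \<le> T \<gamma> b"
    using mem r rule by (intro T_mono T_closed order_refl)
  also note \<gamma>b
  finally have "T (T (T (T \<beta> \<alpha>) \<gamma>) r) s' \<le> I a' b'"
    using mem r by (subst le_R_impl_iff) blast+
  then show ?thesis
    unfolding r_def[symmetric] using mem r by (subst le_R_impl_iff) blast+
qed

lemma le_R_impl_INF:
  fixes f g :: "'a \<Rightarrow> real"
  assumes "W \<noteq> {}" "c \<in> {0..1}"
    and f: "\<And>w. w \<in> W \<Longrightarrow> f w \<in> {0..1}" and g: "\<And>w. w \<in> W \<Longrightarrow> g w \<in> {0..1}"
    and le: "\<And>w. w \<in> W \<Longrightarrow> T c (f w) \<le> g w"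
  shows "c \<le> I (INF w\<in>W. f w) (INF w\<in>W. g w)"
proof -
  have mem: "(INF w\<in>W. f w) \<in> {0..1}" "(INF w\<in>W. g w) \<in> {0..1}"
    using assms by (auto intro!: INF_closed simp del: atLeastAtMost_iff)
  have "T c (INF w\<in>W. f w) \<le> g w" if w: "w \<in> W" for w
  proof -
    have "bdd_below (f ` W)"
      using f by (intro bdd_belowI2[of _ 0]) auto
    then have "(INF w\<in>W. f w) \<le> f w"
      using w by (rule cINF_lower)
    then have "T c (INF w\<in>W. f w) \<le> T c (f w)"
      using assms(2) mem f[OF w] by (intro T_mono order_refl)
    with le[OF w] show ?thesis by simp
  qed
  then have "T c (INF w\<in>W. f w) \<le> (INF w\<in>W. g w)"
    using assms(1) by (intro cINF_greatest)
  then show ?thesis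
    using le_R_impl_iff[OF assms(2) mem] by simp
qed

end

theorem theorem4p12:
  fixes T :: "real \<Rightarrow> real \<Rightarrow> real"
    and U :: "'u set" and V :: "'v set"
    and A A' A'' A\<^sub>1 :: "'u \<Rightarrow> real"
    and B B\<^sub>1 B\<^sub>2' B\<^sub>2'' :: "'v \<Rightarrow> real"
    and \<alpha>\<^sub>1 \<alpha>\<^sub>2 \<alpha>\<^sub>3 \<beta> :: real
  assumes "t_norm T" and "left_continuous T"
    and "U \<noteq> {}" and "V \<noteq> {}"
    and "fuzzy_set U A" and "fuzzy_set U A'" and "fuzzy_set U A''" and "fuzzy_set U A\<^sub>1"
    and "fuzzy_set V B" and "fuzzy_set V B\<^sub>1"
    and "\<alpha>\<^sub>1 \<in> {0..1}" and "\<alpha>\<^sub>2 \<in> {0..1}" and "\<alpha>\<^sub>3 \<in> {0..1}"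
    and "\<And>y. y \<in> V \<Longrightarrow>
           B\<^sub>2' y = (INF x\<in>U. R_impl T (S_F T U A' A) (R_impl T (A x) (B y)))"
    and "\<And>y. y \<in> V \<Longrightarrow>
           B\<^sub>2'' y = (INF x\<in>U. R_impl T (S_F T U A'' A\<^sub>1) (R_impl T (A\<^sub>1 x) (B\<^sub>1 y)))"
    and "\<beta> = F_op T (S_F T U A' A) (S_F T U A'' A\<^sub>1)"
    and "similar T U \<alpha>\<^sub>1 A' A''"
    and "similar T U \<alpha>\<^sub>2 A A\<^sub>1"
    and "similar T V \<alpha>\<^sub>3 B B\<^sub>1"
  shows "similar T V (T (T \<beta> \<alpha>\<^sub>2) \<alpha>\<^sub>3) B\<^sub>2' B\<^sub>2''"
proof -
  interpret left_continuous_t_norm T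
    by (rule left_continuous_t_norm.intro) fact+
  define s where "s = S_F T U A' A"
  define s' where "s' = S_F T U A'' A\<^sub>1"
  have s: "s \<in> {0..1}" "s' \<in> {0..1}"
    unfolding s_def s'_def using assms by (blast intro: S_F_closed)+
  have A: "A x \<in> {0..1}" "A\<^sub>1 x \<in> {0..1}" if "x \<in> U" for x
    using assms that by (auto simp: fuzzy_set_def)
  have B: "B y \<in> {0..1}" "B\<^sub>1 y \<in> {0..1}" if "y \<in> V" for y
    using assms that by (auto simp: fuzzy_set_def)
  have \<beta>_eq: "\<beta> = F_op T s s'"
    unfolding s_def s'_def by fact
  have \<beta>: "\<beta> \<in> {0..1}" "\<beta> \<le> I s s'" "\<beta> \<le> I s' s"
    using F_op_closed[OF s] le_F_op_iff[OF s, of \<beta>] by (auto simp: \<beta>_eq)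
  have \<alpha>\<^sub>2: "\<alpha>\<^sub>2 \<le> I (A x) (A\<^sub>1 x)" "\<alpha>\<^sub>2 \<le> I (A\<^sub>1 x) (A x)" if "x \<in> U" for x
    using that assms similar_iff[of U A A\<^sub>1] by blast+
  have \<alpha>\<^sub>3: "\<alpha>\<^sub>3 \<le> I (B y) (B\<^sub>1 y)" "\<alpha>\<^sub>3 \<le> I (B\<^sub>1 y) (B y)" if "y \<in> V" for y
    using that assms similar_iff[of V B B\<^sub>1] by blast+
  have B2': "B\<^sub>2' y = (INF x\<in>U. I s (I (A x) (B y)))" if "y \<in> V" for y
    using assms that by (simp add: s_def)
  have B2'': "B\<^sub>2'' y = (INF x\<in>U. I s' (I (A\<^sub>1 x) (B\<^sub>1 y)))" if "y \<in> V" for y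
    using assms that by (simp add: s'_def)
  note mem = s A B \<beta>(1) \<open>\<alpha>\<^sub>2 \<in> {0..1}\<close> \<open>\<alpha>\<^sub>3 \<in> {0..1}\<close>
  have "fuzzy_set V B\<^sub>2'" "fuzzy_set V B\<^sub>2''"
    unfolding fuzzy_set_def using mem \<open>U \<noteq> {}\<close>
    by (auto simp: B2' B2'' simp del: atLeastAtMost_iff intro!: INF_closed R_impl_closed)
  moreover have "T (T \<beta> \<alpha>\<^sub>2) \<alpha>\<^sub>3 \<le> I (B\<^sub>2' y) (B\<^sub>2'' y)" if "y \<in> V" for y
    unfolding B2'[OF that] B2''[OF that] using mem that \<open>U \<noteq> {}\<close> \<beta> \<alpha>\<^sub>2 \<alpha>\<^sub>3
    by (intro le_R_impl_INF T_nested_R_impl_le T_closed R_impl_closed)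
  moreover have "T (T \<beta> \<alpha>\<^sub>2) \<alpha>\<^sub>3 \<le> I (B\<^sub>2'' y) (B\<^sub>2' y)" if "y \<in> V" for y
    unfolding B2'[OF that] B2''[OF that] using mem that \<open>U \<noteq> {}\<close> \<beta> \<alpha>\<^sub>2 \<alpha>\<^sub>3
    by (intro le_R_impl_INF T_nested_R_impl_le T_closed R_impl_closed)
  ultimately show ?thesis
    using \<open>V \<noteq> {}\<close> similar_iff[of V B\<^sub>2' B\<^sub>2''] by blast
qed

end
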